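(* Let $X$ be a vector space and $(Y,N)$ a fuzzy Banach space. Let $\varphi:X^3\to[0,\infty)$ be a function such that there exists $L<1$ with $$\varphi\left(\frac x2,\frac y2,\frac z2\right)\le\frac{L\,\varphi(x,y,z)}2\quad\text{for all }x,y,z\in X.$$ Let $f:X\to Y$ be a mapping satisfying $$N\left(f\left(\frac{x+y+z}2\right)+f\left(\frac{x-y+z}2\right)-f(x)-f(z),t\right)\ge\frac t{t+\varphi(x,y,z)}$$ for all $x,y,z\in X$ and all $t>0$. Then the limit $$A(x):=N\text{-}\lim_{n\to\infty}2^nf\left(\frac x{2^n}\right)$$ exists for each $x\in X$ and defines a unique additive mapping $A:X\to Y$ such that $$N(f(x)-A(x),t)\ge\frac{(2-2L)t}{(2-2L)t+L\,\varphi(x,2x,x)}\quad\text{for all }x\in X,\ t>0.$$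
   Context: Vector spaces are real. A fuzzy norm on a real vector space $X$ is a function $N:X\times\mathbb{R}\to[0,1]$ such that for all $x,y\in X$, $s,t\in\mathbb{R}$: (N1) $N(x,t)=0$ for $t\le0$; (N2) $x=0$ iff $N(x,t)=1$ for all $t>0$; (N3) $N(cx,t)=N(x,t/|c|)$ if $c\ne0$; (N4) $N(x+y,s+t)\ge\min\{N(x,s),N(y,t)\}$; (N5) $N(x,\cdot)$ is non-decreasing and $\lim_{t\to\infty}N(x,t)=1$; (N6) for $x\ne0$, $N(x,\cdot)$ is continuous on $\mathbb{R}$. Then $(X,N)$ is a fuzzy normed space. A sequence $x_n$ converges to $x$, written $N\text{-}\lim_{n\to\infty}x_n=x$, if $\lim_{n\to\infty}N(x_n-x,t)=1$ for all $t>0$; it is Cauchy if for every $\epsilon>0$ and $t>0$ there is $n_0$ with $N(x_{n+p}-x_n,t)>1-\epsilon$ for all $n\ge n_0$, $p>0$. A fuzzy Banach space is a fuzzy normed space in which every Cauchy sequence converges. A mapping $A$ is additive if $A(x+y)=A(x)+A(y)$ for all $x,y$.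
   Formalization: The hypothesis f(0)=0 is added: without it the claim fails (φ=0 and f a nonzero constant satisfy every hypothesis, but 2^n f(x/2^n) has no limit); it is necessary for the limit to exist at x=0. *)

theory Defs
  imports "HOL-Analysis.Analysis"
begin

locale fuzzy_normed_space =
  fixes N :: "'b::real_vector \<Rightarrow> real \<Rightarrow> real"
  assumes range: "N x t \<in> {0..1}"
    and N1: "t \<le> 0 \<Longrightarrow> N x t = 0"
    and N2: "x = 0 \<longleftrightarrow> (\<forall>t>0. N x t = 1)"
    and N3: "c \<noteq> 0 \<Longrightarrow> N (c *\<^sub>R x) t = N x (t / \<bar>c\<bar>)"
    and N4: "N (x + y) (s + t) \<ge> min (N x s) (N y t)"
    and N5_mono: "mono (N x)"
    and N5_lim: "(N x \<longlongrightarrow> 1) at_top"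
    and N6: "x \<noteq> 0 \<Longrightarrow> continuous_on UNIV (N x)"

definition fuzzy_LIMSEQ ::
    "('b::real_vector \<Rightarrow> real \<Rightarrow> real) \<Rightarrow> (nat \<Rightarrow> 'b) \<Rightarrow> 'b \<Rightarrow> bool" where
  "fuzzy_LIMSEQ N X l \<longleftrightarrow> (\<forall>t>0. (\<lambda>n. N (X n - l) t) \<longlonglongrightarrow> 1)"

definition fuzzy_convergent ::
    "('b::real_vector \<Rightarrow> real \<Rightarrow> real) \<Rightarrow> (nat \<Rightarrow> 'b) \<Rightarrow> bool" where
  "fuzzy_convergent N X \<longleftrightarrow> (\<exists>l. fuzzy_LIMSEQ N X l)"

definition fuzzy_lim ::
    "('b::real_vector \<Rightarrow> real \<Rightarrow> real) \<Rightarrow> (nat \<Rightarrow> 'b) \<Rightarrow> 'b" where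
  "fuzzy_lim N X = (THE l. fuzzy_LIMSEQ N X l)"

definition fuzzy_Cauchy ::
    "('b::real_vector \<Rightarrow> real \<Rightarrow> real) \<Rightarrow> (nat \<Rightarrow> 'b) \<Rightarrow> bool" where
  "fuzzy_Cauchy N X \<longleftrightarrow>
     (\<forall>\<epsilon>>0. \<forall>t>0. \<exists>n0. \<forall>n\<ge>n0. \<forall>p>0. N (X (n + p) - X n) t > 1 - \<epsilon>)"

locale fuzzy_banach_space = fuzzy_normed_space +
  assumes complete: "fuzzy_Cauchy N X \<Longrightarrow> fuzzy_convergent N X"

context fuzzy_normed_space
begin

lemma fuzzy_LIMSEQ_unique:
  assumes "fuzzy_LIMSEQ N X a" "fuzzy_LIMSEQ N X b"
  shows "a = b"
proof -
  have "N (a - b) t = 1" if t: "t > 0" for t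
  proof -
    have 1: "(\<lambda>n. N (X n - a) (t/2)) \<longlonglongrightarrow> 1" "(\<lambda>n. N (X n - b) (t/2)) \<longlonglongrightarrow> 1"
      using assms t by (auto simp: fuzzy_LIMSEQ_def)
    have lim: "(\<lambda>n. min (N (X n - a) (t/2)) (N (X n - b) (t/2))) \<longlonglongrightarrow> min 1 1"
      by (intro tendsto_min 1)
    have sym: "N (a - X n) (t/2) = N (X n - a) (t/2)" for n
      using N3[of "-1" "X n - a" "t/2"] by simp
    have "min (N (X n - a) (t/2)) (N (X n - b) (t/2)) \<le> N (a - b) t" for n
      using N4[of "a - X n" "t/2" "X n - b" "t/2"] sym[of n] by simp
    then have "1 \<le> N (a - b) t"
      using LIMSEQ_le_const2[OF lim, of "N (a - b) t"] by simp
    moreover have "N (a - b) t \<le> 1" using range[of "a - b" t] by simp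
    ultimately show ?thesis by simp
  qed
  then show ?thesis using N2[of "a - b"] by simp
qed

lemma fuzzy_lim_eqI: "fuzzy_LIMSEQ N X l \<Longrightarrow> fuzzy_lim N X = l"
  unfolding fuzzy_lim_def by (rule the_equality) (auto intro: fuzzy_LIMSEQ_unique)

text \<open>
  Constant maps satisfy the functional equation underlying
  the stability theorem with zero defect, but for a constant \<open>c \<noteq> 0\<close> the sequence
  \<open>2 ^ n *\<^sub>R c\<close> has no fuzzy limit.  Hence the condition \<open>f 0 = 0\<close> cannot be
  derived from the functional inequality, and is necessary for
  \<open>2 ^ n *\<^sub>R f (x /\<^sub>R 2 ^ n)\<close> to converge at \<open>x = 0\<close>.
\<close>

lemma fuzzy_convergent_pow2_imp_zero:
  assumes "fuzzy_convergent N (\<lambda>n. 2 ^ n *\<^sub>R c)"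
  shows "c = 0"
proof -
  from assms obtain l where l: "fuzzy_LIMSEQ N (\<lambda>n. 2 ^ n *\<^sub>R c) l"
    by (auto simp: fuzzy_convergent_def)
  have "N c t = 1" if t: "t > 0" for t
  proof -
    have 1: "(\<lambda>n. N (2 ^ n *\<^sub>R c - l) (t/2)) \<longlonglongrightarrow> 1"
      using l t by (auto simp: fuzzy_LIMSEQ_def)
    have 2: "(\<lambda>n. N (2 ^ Suc n *\<^sub>R c - l) (t/2)) \<longlonglongrightarrow> 1"
      using LIMSEQ_Suc[OF 1] .
    have lim: "(\<lambda>n. min (N (2 ^ Suc n *\<^sub>R c - l) (t/2)) (N (2 ^ n *\<^sub>R c - l) (t/2))) \<longlonglongrightarrow> min 1 1"
      by (intro tendsto_min 1 2)
    have "min (N (2 ^ Suc n *\<^sub>R c - l) (t/2)) (N (2 ^ n *\<^sub>R c - l) (t/2)) \<le> N c t" for n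
    proof -
      have "N (l - 2 ^ n *\<^sub>R c) (t/2) = N (2 ^ n *\<^sub>R c - l) (t/2)"
        using N3[of "-1" "2 ^ n *\<^sub>R c - l" "t/2"] by simp
      moreover have "(2 ^ Suc n *\<^sub>R c - l) + (l - 2 ^ n *\<^sub>R c) = (2::real) ^ n *\<^sub>R c"
        by (simp add: algebra_simps flip: scaleR_add_left scaleR_diff_left)
      ultimately have "min (N (2 ^ Suc n *\<^sub>R c - l) (t/2)) (N (2 ^ n *\<^sub>R c - l) (t/2))
          \<le> N (2 ^ n *\<^sub>R c) t"
        using N4[of "2 ^ Suc n *\<^sub>R c - l" "t/2" "l - 2 ^ n *\<^sub>R c" "t/2"] by simp
      also have "\<dots> = N c (t / 2 ^ n)" using N3[of "2 ^ n" c t] by simp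
      also have "\<dots> \<le> N c t"
        using t by (intro monoD[OF N5_mono]) (simp add: field_simps mult_le_cancel_left1)
      finally show ?thesis .
    qed
    then have "1 \<le> N c t"
      using LIMSEQ_le_const2[OF lim, of "N c t"] by simp
    moreover have "N c t \<le> 1" using range[of c t] by simp
    ultimately show ?thesis by simp
  qed
  then show ?thesis using N2[of c] by simp
qed

end

end

theory Submission
  imports Defs
begin

text \<open>
  Call \<open>z\<close> of fuzzy size at most \<open>\<alpha>\<close> if \<open>N z t \<ge> t / (t + \<alpha>)\<close> for all \<open>t > 0\<close>.  These are exactly
  the lower bounds that occur in the theorem, and this relation behaves like \<open>\<parallel>z\<parallel> \<le> \<alpha>\<close> for an
  honest norm: it scales, it satisfies the triangle inequality (\<open>fuzzy_norm_le_add\<close>), it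
  passes to fuzzy limits (\<open>fuzzy_norm_le_limit\<close>), and sizes tending to \<open>0\<close> force fuzzy convergence
  to \<open>0\<close> (\<open>fuzzy_LIMSEQ_I\<close>).  The theorem thereby becomes an instance of the classical direct
  method of Hyers (\<open>approximately_additive_stability\<close>).

  For \<open>y = x + z\<close> the second summand in the functional inequality is \<open>f 0 = 0\<close>, so \<open>f\<close> is
  approximately additive, with defect \<open>\<psi> x z = \<phi> x (x + z) z\<close> that satisfies
  \<open>\<psi> (x/2) (z/2) \<le> (L/2) \<psi> x z\<close>.  The case \<open>z = x\<close> bounds the steps of \<open>2\<^sup>n f (x/2\<^sup>n)\<close> by the
  geometric sequence \<open>(L/2) L\<^sup>n \<psi> x x\<close>.  Its sum \<open>L \<psi> x x / (2 - 2 L)\<close> gives both convergence and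
  the distance from \<open>f x\<close> to the limit \<open>A x\<close> (\<open>fuzzy_geometric_steps\<close>).  The defect of
  \<open>x \<mapsto> 2\<^sup>n f (x/2\<^sup>n)\<close> is at most \<open>L\<^sup>n \<psi> x z\<close>, which tends to \<open>0\<close>, so \<open>A\<close> is additive; and for any
  additive \<open>B\<close> as close to \<open>f\<close> the same rescaling shows that \<open>2\<^sup>n f (x/2\<^sup>n)\<close> tends to \<open>B x\<close>, so
  \<open>B = A\<close> by uniqueness of fuzzy limits.
\<close>

section \<open>Elements of bounded fuzzy size\<close>

context fuzzy_normed_space
begin

definition fuzzy_norm_le :: "'b \<Rightarrow> real \<Rightarrow> bool" where
  "fuzzy_norm_le z \<alpha> \<longleftrightarrow> 0 \<le> \<alpha> \<and> (\<forall>t>0. t / (t + \<alpha>) \<le> N z t)"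

lemma fuzzy_norm_leD: "fuzzy_norm_le z \<alpha> \<Longrightarrow> t > 0 \<Longrightarrow> t / (t + \<alpha>) \<le> N z t"
  by (simp add: fuzzy_norm_le_def)

lemma N_le_1: "N z t \<le> 1"
  using range[of z t] by simp

lemma fuzzy_norm_le_zero: "0 \<le> \<alpha> \<Longrightarrow> fuzzy_norm_le 0 \<alpha>"
  using N2[of 0] by (simp add: fuzzy_norm_le_def)

lemma fuzzy_norm_le_0_imp_eq_0:
  assumes "fuzzy_norm_le z 0"
  shows "z = 0"
proof -
  have "N z t = 1" if "t > 0" for t
    using fuzzy_norm_leD[OF assms that] N_le_1[of z t] that by simp
  then show ?thesis using N2[of z] by simp
qed

lemma fuzzy_norm_le_mono:
  assumes "fuzzy_norm_le z \<alpha>" "\<alpha> \<le> \<beta>"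
  shows "fuzzy_norm_le z \<beta>"
  unfolding fuzzy_norm_le_def
proof (intro conjI allI impI)
  show "0 \<le> \<beta>" using assms by (simp add: fuzzy_norm_le_def)
  fix t :: real assume t: "t > 0"
  have "t / (t + \<beta>) \<le> t / (t + \<alpha>)"
    using assms t by (intro divide_left_mono) (auto simp: fuzzy_norm_le_def intro!: mult_pos_pos)
  also have "\<dots> \<le> N z t" using assms(1) t by (rule fuzzy_norm_leD)
  finally show "t / (t + \<beta>) \<le> N z t" .
qed

lemma fuzzy_norm_le_scaleR:
  assumes "fuzzy_norm_le z \<alpha>" "c \<noteq> 0"
  shows "fuzzy_norm_le (c *\<^sub>R z) (\<bar>c\<bar> * \<alpha>)"
  unfolding fuzzy_norm_le_def
proof (intro conjI allI impI)
  show "0 \<le> \<bar>c\<bar> * \<alpha>" using assms by (simp add: fuzzy_norm_le_def)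
  fix t :: real assume t: "t > 0"
  have "t / (t + \<bar>c\<bar> * \<alpha>) = (t / \<bar>c\<bar>) / (t / \<bar>c\<bar> + \<alpha>)"
    using assms(2) by (simp add: field_simps)
  also have "\<dots> \<le> N z (t / \<bar>c\<bar>)"
    using assms t by (intro fuzzy_norm_leD) auto
  finally show "t / (t + \<bar>c\<bar> * \<alpha>) \<le> N (c *\<^sub>R z) t"
    using N3[OF assms(2)] by simp
qed

lemma fuzzy_norm_le_minus_commute:
  "fuzzy_norm_le (x - y) \<alpha> \<Longrightarrow> fuzzy_norm_le (y - x) \<alpha>"
  using fuzzy_norm_le_scaleR[of "x - y" \<alpha> "-1"] by simp

text \<open>
  Splitting \<open>t\<close> in the proportion \<open>\<alpha> : \<beta>\<close> makes both arguments of the minimum in (N4) at least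
  \<open>t / (t + (\<alpha> + \<beta>))\<close>.  The splitting needs \<open>\<alpha>, \<beta> > 0\<close>; an element of size \<open>0\<close> vanishes.
\<close>

lemma fuzzy_norm_le_add:
  assumes x: "fuzzy_norm_le x \<alpha>" and y: "fuzzy_norm_le y \<beta>"
  shows "fuzzy_norm_le (x + y) (\<alpha> + \<beta>)"
proof -
  consider "\<alpha> = 0" | "\<beta> = 0" | "\<alpha> > 0" "\<beta> > 0"
    using x y unfolding fuzzy_norm_le_def by linarith
  then show ?thesis
  proof cases
    case 1
    then show ?thesis using x y fuzzy_norm_le_0_imp_eq_0[of x] by simp
  next
    case 2
    then show ?thesis using x y fuzzy_norm_le_0_imp_eq_0[of y] by simp
  next
    case 3
    have "t / (t + (\<alpha> + \<beta>)) \<le> N (x + y) t" if t: "t > 0" for t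
    proof -
      define s where "s = t / (\<alpha> + \<beta>)"
      have s: "s > 0" using t 3 by (simp add: s_def)
      have "t = s * (\<alpha> + \<beta>)" using 3 by (simp add: s_def)
      then have ts: "t = s * \<alpha> + s * \<beta>" by (simp add: distrib_left)
      have ratio: "s * \<gamma> / (s * \<gamma> + \<gamma>) = s / (s + 1)" if "\<gamma> > 0" for \<gamma>
      proof -
        have "s * \<gamma> + \<gamma> = (s + 1) * \<gamma>" by (simp add: distrib_right)
        then show ?thesis using that by simp
      qed
      have "t / (t + (\<alpha> + \<beta>)) = s / (s + 1)"
        using ratio[of "\<alpha> + \<beta>"] 3 ts by (simp add: distrib_left)
      moreover have "s / (s + 1) \<le> N x (s * \<alpha>)"
        using fuzzy_norm_leD[OF x, of "s * \<alpha>"] ratio[of \<alpha>] s 3 by simp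
      moreover have "s / (s + 1) \<le> N y (s * \<beta>)"
        using fuzzy_norm_leD[OF y, of "s * \<beta>"] ratio[of \<beta>] s 3 by simp
      ultimately show ?thesis using N4[of x "s * \<alpha>" y "s * \<beta>"] ts by simp
    qed
    then show ?thesis using 3 by (simp add: fuzzy_norm_le_def)
  qed
qed

section \<open>Fuzzy convergence through fuzzy sizes\<close>

lemma fuzzy_size_bound_tendsto_1:
  fixes r :: "nat \<Rightarrow> real"
  assumes "r \<longlonglongrightarrow> 0" "t > 0"
  shows "(\<lambda>n. t / (t + r n)) \<longlonglongrightarrow> 1"
proof -
  have "(\<lambda>n. t / (t + r n)) \<longlonglongrightarrow> t / (t + 0)"
    using assms by (intro tendsto_intros) auto
  then show ?thesis using assms by simp
qed

lemma fuzzy_LIMSEQ_I: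
  assumes "\<And>n. fuzzy_norm_le (X n - l) (r n)" "r \<longlonglongrightarrow> 0"
  shows "fuzzy_LIMSEQ N X l"
  unfolding fuzzy_LIMSEQ_def
proof (intro allI impI)
  fix t :: real assume t: "t > 0"
  show "(\<lambda>n. N (X n - l) t) \<longlonglongrightarrow> 1"
  proof (rule real_tendsto_sandwich)
    show "(\<lambda>n. t / (t + r n)) \<longlonglongrightarrow> 1" "(\<lambda>n. 1 :: real) \<longlonglongrightarrow> 1"
      using fuzzy_size_bound_tendsto_1[OF assms(2) t] by auto
  qed (use fuzzy_norm_leD[OF assms(1) t] N_le_1 in auto)
qed

lemma fuzzy_CauchyI:
  assumes bound: "\<And>n p. fuzzy_norm_le (X (n + p) - X n) (r n)" and r: "r \<longlonglongrightarrow> 0"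
  shows "fuzzy_Cauchy N X"
  unfolding fuzzy_Cauchy_def
proof (intro allI impI)
  fix \<epsilon> t :: real assume \<epsilon>: "\<epsilon> > 0" and t: "t > 0"
  have "eventually (\<lambda>n. t / (t + r n) > 1 - \<epsilon>) sequentially"
    using order_tendstoD(1)[OF fuzzy_size_bound_tendsto_1[OF r t], of "1 - \<epsilon>"] \<epsilon> by simp
  then obtain n0 where "t / (t + r n) > 1 - \<epsilon>" if "n \<ge> n0" for n
    by (auto simp: eventually_sequentially)
  then show "\<exists>n0. \<forall>n\<ge>n0. \<forall>p>0. N (X (n + p) - X n) t > 1 - \<epsilon>"
    using fuzzy_norm_leD[OF bound t] by (meson less_le_trans)
qed

lemma fuzzy_LIMSEQ_diff:
  assumes X: "fuzzy_LIMSEQ N X a" and Y: "fuzzy_LIMSEQ N Y b"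
  shows "fuzzy_LIMSEQ N (\<lambda>n. X n - Y n) (a - b)"
  unfolding fuzzy_LIMSEQ_def
proof (intro allI impI)
  fix t :: real assume t: "t > 0"
  have lim: "(\<lambda>n. min (N (X n - a) (t/2)) (N (Y n - b) (t/2))) \<longlonglongrightarrow> min 1 1"
    using X Y t by (intro tendsto_min) (auto simp: fuzzy_LIMSEQ_def)
  have le: "min (N (X n - a) (t/2)) (N (Y n - b) (t/2)) \<le> N (X n - Y n - (a - b)) t" for n
  proof -
    have "N (b - Y n) (t/2) = N (Y n - b) (t/2)"
      using N3[of "-1" "Y n - b" "t/2"] by simp
    then show ?thesis
      using N4[of "X n - a" "t/2" "b - Y n" "t/2"] by (simp add: algebra_simps)
  qed
  show "(\<lambda>n. N (X n - Y n - (a - b)) t) \<longlonglongrightarrow> 1"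
    by (rule real_tendsto_sandwich[OF _ _ lim[simplified] tendsto_const]) (use le N_le_1 in auto)
qed

text \<open>
  (N4) gives \<open>N (l - y) t\<close> the bound that belongs to \<open>t - e\<close>, for every \<open>0 < e < t\<close>, because the
  remaining \<open>e\<close> absorbs \<open>l - X n\<close>.  Continuity of the bound in \<open>t\<close> then removes \<open>e\<close>.
\<close>

lemma fuzzy_norm_le_limit:
  assumes X: "fuzzy_LIMSEQ N X l" and bound: "\<And>n. fuzzy_norm_le (X n - y) \<alpha>"
  shows "fuzzy_norm_le (l - y) \<alpha>"
  unfolding fuzzy_norm_le_def
proof (intro conjI allI impI)
  show \<alpha>: "0 \<le> \<alpha>" using bound[of 0] by (simp add: fuzzy_norm_le_def)
  fix t :: real assume t: "t > 0"
  have approx: "(t - e) / (t - e + \<alpha>) \<le> N (l - y) t" if e: "0 < e" "e < t" for e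
  proof -
    have "(\<lambda>n. N (X n - l) e) \<longlonglongrightarrow> 1" using X e by (auto simp: fuzzy_LIMSEQ_def)
    then have lim: "(\<lambda>n. min ((t - e) / (t - e + \<alpha>)) (N (X n - l) e))
        \<longlonglongrightarrow> min ((t - e) / (t - e + \<alpha>)) 1"
      by (intro tendsto_min tendsto_const)
    have "min ((t - e) / (t - e + \<alpha>)) (N (X n - l) e) \<le> N (l - y) t" for n
    proof -
      have "N (l - X n) e = N (X n - l) e"
        using N3[of "-1" "X n - l" e] by simp
      then show ?thesis
        using N4[of "X n - y" "t - e" "l - X n" e] fuzzy_norm_leD[OF bound[of n], of "t - e"] e
        by simp
    qed
    then have "min ((t - e) / (t - e + \<alpha>)) 1 \<le> N (l - y) t"
      using LIMSEQ_le_const2[OF lim, of "N (l - y) t"] by simp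
    moreover have "(t - e) / (t - e + \<alpha>) \<le> 1" using e \<alpha> by simp
    ultimately show ?thesis by simp
  qed
  have "((\<lambda>e. (t - e) / (t - e + \<alpha>)) \<longlongrightarrow> (t - 0) / (t - 0 + \<alpha>)) (at_right 0)"
    using t \<alpha> by (intro tendsto_intros) auto
  moreover have "eventually (\<lambda>e. (t - e) / (t - e + \<alpha>) \<le> N (l - y) t) (at_right 0)"
    using approx eventually_at_right_real[OF t] by (auto elim!: eventually_mono)
  ultimately show "t / (t + \<alpha>) \<le> N (l - y) t"
    using tendsto_upperbound[of "\<lambda>e. (t - e) / (t - e + \<alpha>)"] by fastforce
qed

end

text \<open>
  The distance between any two terms is bounded by a piece of the geometric series, hence by the
  tail \<open>c K\<^sup>n / (1 - K)\<close>.  This makes the sequence Cauchy, and for \<open>n = 0\<close> it locates the limit.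
\<close>

lemma (in fuzzy_banach_space) fuzzy_geometric_steps:
  assumes steps: "\<And>n. fuzzy_norm_le (X (Suc n) - X n) (c * K ^ n)"
    and K: "0 \<le> K" "K < 1"
  obtains l where "fuzzy_LIMSEQ N X l" "fuzzy_norm_le (l - X 0) (c / (1 - K))"
proof -
  have c: "0 \<le> c" using steps[of 0] by (simp add: fuzzy_norm_le_def)
  have partial: "fuzzy_norm_le (X (n + p) - X n) (c * (K ^ n - K ^ (n + p)) / (1 - K))" for n p
  proof (induction p)
    case 0
    show ?case by (simp add: fuzzy_norm_le_zero)
  next
    case (Suc p)
    have "c * (K ^ n - K ^ (n + p)) / (1 - K) + c * K ^ (n + p)
        = c * (K ^ n - K ^ (n + Suc p)) / (1 - K)"
      using K by (simp add: divide_simps) (simp add: algebra_simps)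
    then show ?case
      using fuzzy_norm_le_add[OF Suc steps[of "n + p"]] by (simp add: algebra_simps)
  qed
  have bound: "fuzzy_norm_le (X (n + p) - X n) (c * K ^ n / (1 - K))" for n p
    using K c by (intro fuzzy_norm_le_mono[OF partial] divide_right_mono mult_left_mono) auto
  have "(\<lambda>n. c * K ^ n / (1 - K)) \<longlonglongrightarrow> c * 0 / (1 - K)"
    using K by (intro tendsto_intros LIMSEQ_power_zero) auto
  then have "fuzzy_Cauchy N X"
    by (intro fuzzy_CauchyI[OF bound]) simp
  then obtain l where l: "fuzzy_LIMSEQ N X l"
    using complete by (auto simp: fuzzy_convergent_def)
  show ?thesis
  proof (rule that[OF l])
    show "fuzzy_norm_le (l - X 0) (c / (1 - K))"
      using bound[of 0] by (intro fuzzy_norm_le_limit[OF l]) simp_all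
  qed
qed

section \<open>Stability of additive maps in a fuzzy Banach space\<close>

lemma additive_halving_iterate:
  fixes B :: "'a::real_vector \<Rightarrow> 'b::real_vector"
  assumes "Modules.additive B"
  shows "2 ^ n *\<^sub>R B (x /\<^sub>R 2 ^ n) = B x"
proof (induction n)
  case (Suc n)
  have "B (x /\<^sub>R 2 ^ n) = B (x /\<^sub>R 2 ^ Suc n + x /\<^sub>R 2 ^ Suc n)"
    by (simp flip: scaleR_add_left)
  also have "\<dots> = 2 *\<^sub>R B (x /\<^sub>R 2 ^ Suc n)"
    using additive.add[OF assms] by (simp add: scaleR_2)
  finally show ?case using Suc by (simp add: mult.commute)
qed simp

lemma halving_defect_iterate:
  fixes \<psi> :: "'a::real_vector \<Rightarrow> 'a \<Rightarrow> real"
  assumes "\<And>x z. \<psi> (x /\<^sub>R 2) (z /\<^sub>R 2) \<le> K * \<psi> x z / 2" and "0 \<le> K"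
  shows "2 ^ n * \<psi> (x /\<^sub>R 2 ^ n) (z /\<^sub>R 2 ^ n) \<le> K ^ n * \<psi> x z"
proof (induction n)
  case (Suc n)
  have "2 ^ Suc n * \<psi> (x /\<^sub>R 2 ^ Suc n) (z /\<^sub>R 2 ^ Suc n)
      \<le> 2 ^ Suc n * (K * \<psi> (x /\<^sub>R 2 ^ n) (z /\<^sub>R 2 ^ n) / 2)"
    using assms(1)[of "x /\<^sub>R 2 ^ n" "z /\<^sub>R 2 ^ n"] by simp
  also have "\<dots> = K * (2 ^ n * \<psi> (x /\<^sub>R 2 ^ n) (z /\<^sub>R 2 ^ n))" by simp
  also have "\<dots> \<le> K * (K ^ n * \<psi> x z)"
    using Suc assms(2) by (rule mult_left_mono)
  finally show ?case by (simp add: mult.assoc)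
qed simp

text \<open>
  The direct method of Hyers.  Uniqueness is stated in the stronger form that the rescaled maps
  converge to every additive \<open>B\<close> that stays this close to \<open>f\<close>.
\<close>

lemma (in fuzzy_banach_space) approximately_additive_stability:
  fixes f :: "'c::real_vector \<Rightarrow> 'a" and \<psi> :: "'c \<Rightarrow> 'c \<Rightarrow> real"
  assumes defect: "\<And>x z. fuzzy_norm_le (f (x + z) - f x - f z) (\<psi> x z)"
    and halving: "\<And>x z. \<psi> (x /\<^sub>R 2) (z /\<^sub>R 2) \<le> K * \<psi> x z / 2"
    and K: "0 \<le> K" "K < 1"
  obtains A where "\<And>x. fuzzy_LIMSEQ N (\<lambda>n. 2 ^ n *\<^sub>R f (x /\<^sub>R 2 ^ n)) (A x)"
    and "Modules.additive A"
    and "\<And>x. fuzzy_norm_le (f x - A x) (K * \<psi> x x / (2 - 2 * K))"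
    and "\<And>B x. Modules.additive B \<Longrightarrow>
      (\<And>y. fuzzy_norm_le (f y - B y) (K * \<psi> y y / (2 - 2 * K))) \<Longrightarrow>
      fuzzy_LIMSEQ N (\<lambda>n. 2 ^ n *\<^sub>R f (x /\<^sub>R 2 ^ n)) (B x)"
proof -
  let ?F = "\<lambda>x n. 2 ^ n *\<^sub>R f (x /\<^sub>R 2 ^ n)"
  note iterate = halving_defect_iterate[of \<psi>, OF halving K(1)]
  have tendsto_0: "(\<lambda>n. K ^ n * c) \<longlonglongrightarrow> 0" for c
    using K tendsto_mult_left_zero[OF LIMSEQ_power_zero[of K]] by simp
  have rescaled_defect: "fuzzy_norm_le (?F (x + z) n - ?F x n - ?F z n) (K ^ n * \<psi> x z)" for x z n
    using fuzzy_norm_le_mono[OF fuzzy_norm_le_scaleR[OF defect, of "2 ^ n"]]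
      iterate[of n x z] by (simp add: algebra_simps)
  have step: "fuzzy_norm_le (?F x (Suc n) - ?F x n) (K * \<psi> x x / 2 * K ^ n)" for x n
  proof -
    let ?h = "x /\<^sub>R 2 ^ Suc n"
    have "?h + ?h = x /\<^sub>R 2 ^ n" by (simp flip: scaleR_add_left)
    moreover have "2 ^ n *\<^sub>R (u - v - v) = 2 ^ n *\<^sub>R u - 2 ^ Suc n *\<^sub>R v" for u v :: 'a
      by (simp add: scaleR_diff_right scaleR_2 flip: scaleR_scaleR)
    ultimately have "2 ^ n *\<^sub>R (f (?h + ?h) - f ?h - f ?h) = ?F x n - ?F x (Suc n)"
      by (simp only:)
    then have "fuzzy_norm_le (?F x n - ?F x (Suc n)) (2 ^ n * \<psi> ?h ?h)"
      using fuzzy_norm_le_scaleR[OF defect[of ?h ?h], of "2 ^ n"] by simp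
    moreover have "2 ^ n * \<psi> ?h ?h \<le> K * \<psi> x x / 2 * K ^ n"
      using iterate[of "Suc n" x x] by (simp add: mult.commute mult.left_commute)
    ultimately show ?thesis
      using fuzzy_norm_le_mono fuzzy_norm_le_minus_commute by blast
  qed
  have "\<exists>l. fuzzy_LIMSEQ N (?F x) l \<and> fuzzy_norm_le (f x - l) (K * \<psi> x x / (2 - 2 * K))" for x
  proof -
    obtain l where l: "fuzzy_LIMSEQ N (?F x) l"
        "fuzzy_norm_le (l - ?F x 0) (K * \<psi> x x / 2 / (1 - K))"
      using fuzzy_geometric_steps[OF step K, of x] by blast
    have "K * \<psi> x x / 2 / (1 - K) = K * \<psi> x x / (2 - 2 * K)" by (simp add: algebra_simps)
    then show ?thesis using l fuzzy_norm_le_minus_commute[of l "f x"] by auto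
  qed
  then obtain A where lim: "\<And>x. fuzzy_LIMSEQ N (?F x) (A x)"
    and close: "\<And>x. fuzzy_norm_le (f x - A x) (K * \<psi> x x / (2 - 2 * K))"
    by metis
  show ?thesis
  proof (rule that[OF lim _ close])
    show "Modules.additive A"
    proof
      fix x z
      have "fuzzy_LIMSEQ N (\<lambda>n. ?F (x + z) n - ?F x n - ?F z n) (A (x + z) - A x - A z)"
        by (intro fuzzy_LIMSEQ_diff lim)
      moreover have "fuzzy_LIMSEQ N (\<lambda>n. ?F (x + z) n - ?F x n - ?F z n) 0"
        by (rule fuzzy_LIMSEQ_I[OF _ tendsto_0]) (use rescaled_defect in simp)
      ultimately have "A (x + z) - A x - A z = 0" by (rule fuzzy_LIMSEQ_unique)
      then show "A (x + z) = A x + A z" by (simp add: algebra_simps)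
    qed
  next
    fix B :: "'c \<Rightarrow> 'a" and x :: 'c
    assume B: "Modules.additive B"
      and close_B: "\<And>y. fuzzy_norm_le (f y - B y) (K * \<psi> y y / (2 - 2 * K))"
    let ?h = "\<lambda>n. x /\<^sub>R 2 ^ n"
    show "fuzzy_LIMSEQ N (?F x) (B x)"
    proof (rule fuzzy_LIMSEQ_I[OF _ tendsto_0])
      fix n
      have "2 ^ n *\<^sub>R (f (?h n) - B (?h n)) = ?F x n - B x"
        using additive_halving_iterate[OF B, of n x] by (simp add: scaleR_diff_right)
      then have "fuzzy_norm_le (?F x n - B x) (2 ^ n * (K * \<psi> (?h n) (?h n) / (2 - 2 * K)))"
        using fuzzy_norm_le_scaleR[OF close_B[of "?h n"], of "2 ^ n"] by simp
      moreover have "2 ^ n * (K * \<psi> (?h n) (?h n) / (2 - 2 * K))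
          \<le> K ^ n * (K * \<psi> x x / (2 - 2 * K))"
        using mult_left_mono[OF iterate[of n x x], of "K / (2 - 2 * K)"] K
        by (simp add: mult.commute mult.left_commute)
      ultimately show "fuzzy_norm_le (?F x n - B x) (K ^ n * (K * \<psi> x x / (2 - 2 * K)))"
        by (rule fuzzy_norm_le_mono)
    qed
  qed
qed

theorem theorem4p5:
  fixes N :: "'b::real_vector \<Rightarrow> real \<Rightarrow> real"
    and \<phi> :: "'a::real_vector \<Rightarrow> 'a \<Rightarrow> 'a \<Rightarrow> real"
    and L :: real
    and f :: "'a \<Rightarrow> 'b"
  assumes Y: "fuzzy_banach_space N"
    and phi_nonneg: "\<And>x y z. \<phi> x y z \<ge> 0"
    and L: "L < 1"
    and phi: "\<And>x y z. \<phi> (x /\<^sub>R 2) (y /\<^sub>R 2) (z /\<^sub>R 2) \<le> L * \<phi> x y z / 2"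
    and f0: "f 0 = 0"
    and f: "\<And>x y z t. t > 0 \<Longrightarrow>
      N (f ((x + y + z) /\<^sub>R 2) + f ((x - y + z) /\<^sub>R 2) - f x - f z) t \<ge> t / (t + \<phi> x y z)"
  shows "(\<forall>x. fuzzy_convergent N (\<lambda>n. 2 ^ n *\<^sub>R f (x /\<^sub>R 2 ^ n))) \<and>
    (let A = (\<lambda>x. fuzzy_lim N (\<lambda>n. 2 ^ n *\<^sub>R f (x /\<^sub>R 2 ^ n))) in
       Modules.additive A \<and>
       (\<forall>x. \<forall>t>0. N (f x - A x) t
          \<ge> (2 - 2 * L) * t / ((2 - 2 * L) * t + L * \<phi> x (2 *\<^sub>R x) x)) \<and>
       (\<forall>B. Modules.additive B \<and>
          (\<forall>x. \<forall>t>0. N (f x - B x) t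
             \<ge> (2 - 2 * L) * t / ((2 - 2 * L) * t + L * \<phi> x (2 *\<^sub>R x) x))
          \<longrightarrow> B = A))"
proof -
  interpret fuzzy_banach_space N by (rule Y)
  define \<psi> where "\<psi> = (\<lambda>x z. \<phi> x (x + z) z)"
  \<comment> \<open>A negative \<open>L\<close> forces \<open>\<phi> = 0\<close>, so that it can be replaced by \<open>0\<close>.\<close>
  define K where "K = max L 0"
  have K: "0 \<le> K" "K < 1" using L by (auto simp: K_def)
  have phi_0: "\<phi> x y z = 0" if "L < 0" for x y z
  proof -
    have "0 \<le> L * \<phi> x y z / 2" by (rule order_trans[OF phi_nonneg phi])
    then show ?thesis using that phi_nonneg[of x y z] by (simp add: zero_le_mult_iff)
  qed
  have K_phi: "K * \<phi> x y z = L * \<phi> x y z" for x y z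
    using phi_0 by (auto simp: K_def max_def)
  have halving: "\<psi> (x /\<^sub>R 2) (z /\<^sub>R 2) \<le> K * \<psi> x z / 2" for x z
    using phi[of x "x + z" z] by (simp add: \<psi>_def K_phi scaleR_add_right)
  have defect: "fuzzy_norm_le (f (x + z) - f x - f z) (\<psi> x z)" for x z
  proof -
    have "x + (x + z) + z = 2 *\<^sub>R (x + z)" by (simp add: scaleR_2)
    then have "(x + (x + z) + z) /\<^sub>R 2 = x + z" by simp
    then show ?thesis
      using f[of _ x "x + z" z] phi_nonneg f0 by (simp add: fuzzy_norm_le_def \<psi>_def)
  qed
  have bound: "fuzzy_norm_le w (K * \<psi> x x / (2 - 2 * K)) \<longleftrightarrow>
      (\<forall>t>0. N w t \<ge> (2 - 2 * L) * t / ((2 - 2 * L) * t + L * \<phi> x (2 *\<^sub>R x) x))" for w x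
  proof -
    have eq: "K * \<psi> x x / (2 - 2 * K) = L * \<phi> x (2 *\<^sub>R x) x / (2 - 2 * L)"
      using phi_0 by (cases "L < 0") (auto simp: \<psi>_def K_def scaleR_2)
    have "0 \<le> K * \<psi> x x / (2 - 2 * K)"
      using K phi_nonneg by (simp add: \<psi>_def)
    moreover have "t / (t + L * \<phi> x (2 *\<^sub>R x) x / (2 - 2 * L))
        = (2 - 2 * L) * t / ((2 - 2 * L) * t + L * \<phi> x (2 *\<^sub>R x) x)" for t
    proof -
      have "(2 - 2 * L) * t + L * \<phi> x (2 *\<^sub>R x) x
          = (2 - 2 * L) * (t + L * \<phi> x (2 *\<^sub>R x) x / (2 - 2 * L))"
        using L by (simp add: distrib_left)
      then show ?thesis using L by simp
    qed
    ultimately show ?thesis by (simp add: fuzzy_norm_le_def eq)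
  qed
  obtain A where lim: "\<And>x. fuzzy_LIMSEQ N (\<lambda>n. 2 ^ n *\<^sub>R f (x /\<^sub>R 2 ^ n)) (A x)"
    and additive: "Modules.additive A"
    and close: "\<And>x. fuzzy_norm_le (f x - A x) (K * \<psi> x x / (2 - 2 * K))"
    and unique: "\<And>B x. Modules.additive B \<Longrightarrow>
      (\<And>y. fuzzy_norm_le (f y - B y) (K * \<psi> y y / (2 - 2 * K))) \<Longrightarrow>
      fuzzy_LIMSEQ N (\<lambda>n. 2 ^ n *\<^sub>R f (x /\<^sub>R 2 ^ n)) (B x)"
    using approximately_additive_stability[of f \<psi> K, OF defect halving K] by blast
  have A_eq: "(\<lambda>x. fuzzy_lim N (\<lambda>n. 2 ^ n *\<^sub>R f (x /\<^sub>R 2 ^ n))) = A"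
    using fuzzy_lim_eqI[OF lim] by (rule ext)
  have "B = A" if "Modules.additive B"
    and "\<And>y. fuzzy_norm_le (f y - B y) (K * \<psi> y y / (2 - 2 * K))" for B
    using fuzzy_LIMSEQ_unique[OF unique[OF that] lim] by (rule ext)
  then show ?thesis
    unfolding A_eq Let_def bound[symmetric] fuzzy_convergent_def
    using lim additive close by blast
qed

end
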